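(* A querier must make $\log(n)$ queries to determine a pure Nash equilibrium of a symmetric network congestion game played on parallel links. That is, any algorithm that, for every $n$-player congestion game on parallel links, determines a pure Nash equilibrium by means of (adaptive) queries must make at least $\log_2 n$ queries in the worst case.
   Context: A symmetric congestion game on $m$ parallel links has $n$ players and links $1,\dots,m$, each player choosing exactly one link. Link $e$ has a non-negative, non-decreasing cost function $f_e:\mathbb N\to\mathbb R_{\ge0}$. In an outcome $s$, let $n_e(s)$ be the number of players on link $e$; each player on link $e$ pays $f_e(n_e(s))$. An outcome $s$ is a pure Nash equilibrium if no player can strictly decrease her cost by unilaterally switching to another link, i.e. for all links $i$ with $n_i(s)\ge1$ and all $j\neq i$, $f_i(n_i(s))\le f_j(n_j(s)+1)$. Initially the querier knows only $n$ and $m$, not the cost functions. A query is a tuple $q=(q_1,\dots,q_m)$ with $q_i\in\{0,\dots,n\}$; the response is the cost $f_i(q_i)$ of each link $i$. With $Q=\sum_i q_i$, it is a normal-query if $Q=n$, an under-query if $Q<n$, and an over-query if $n<Q\le mn$. The lower bound is for queries of any of these types. Algorithms are deterministic and computationally unbounded. *)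

theory Defs
  imports Complex_Main
begin

text \<open>
  Links are \<open>0, \<dots>, m - 1\<close> and players are \<open>0, \<dots>, n - 1\<close>; \<open>f e x\<close> is the cost of link \<open>e\<close>
  when it is used by \<open>x\<close> players.
\<close>

type_synonym costs = "nat \<Rightarrow> nat \<Rightarrow> real"
type_synonym outcome = "nat \<Rightarrow> nat"

definition parallel_links_game :: "nat \<Rightarrow> costs \<Rightarrow> bool" where
  "parallel_links_game m f \<longleftrightarrow> (\<forall>e<m. mono (f e) \<and> (\<forall>x. 0 \<le> f e x))"

definition is_outcome :: "nat \<Rightarrow> nat \<Rightarrow> outcome \<Rightarrow> bool" where
  "is_outcome n m s \<longleftrightarrow> (\<forall>p<n. s p < m)"

definition load :: "nat \<Rightarrow> outcome \<Rightarrow> nat \<Rightarrow> nat" where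
  "load n s e = card {p. p < n \<and> s p = e}"

definition player_cost :: "nat \<Rightarrow> costs \<Rightarrow> outcome \<Rightarrow> nat \<Rightarrow> real" where
  "player_cost n f s p = f (s p) (load n s (s p))"

definition pure_nash :: "nat \<Rightarrow> nat \<Rightarrow> costs \<Rightarrow> outcome \<Rightarrow> bool" where
  "pure_nash n m f s \<longleftrightarrow> is_outcome n m s \<and>
     (\<forall>p<n. \<forall>j<m. player_cost n f s p \<le> player_cost n f (s(p := j)) p)"

lemma load_switch:
  assumes "p < n" "j \<noteq> s p"
  shows "load n (s(p := j)) j = Suc (load n s j)"
proof -
  have "{x. x < n \<and> (s(p := j)) x = j} = insert p {x. x < n \<and> s x = j}"
    using assms by auto
  then show ?thesis
    using assms by (simp add: load_def)
qed

lemma pure_nash_iff_loads: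
  "pure_nash n m f s \<longleftrightarrow> is_outcome n m s \<and>
     (\<forall>i<m. \<forall>j<m. 1 \<le> load n s i \<longrightarrow> i \<noteq> j \<longrightarrow> f i (load n s i) \<le> f j (load n s j + 1))"
    (is "?L \<longleftrightarrow> _ \<and> ?R")
proof -
  have used: "1 \<le> load n s i \<longleftrightarrow> (\<exists>p<n. s p = i)" for i
    by (auto simp: load_def Suc_le_eq card_gt_0_iff)
  have dev: "player_cost n f (s(p := j)) p =
      (if j = s p then f (s p) (load n s (s p)) else f j (load n s j + 1))" if "p < n" for p j
    using that load_switch[of p n j s] by (auto simp: player_cost_def)
  show ?thesis
  proof (cases "is_outcome n m s")
    case True
    have "(\<forall>p<n. \<forall>j<m. player_cost n f s p \<le> player_cost n f (s(p := j)) p) \<longleftrightarrow>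
      (\<forall>p<n. \<forall>j<m. s p \<noteq> j \<longrightarrow> f (s p) (load n s (s p)) \<le> f j (load n s j + 1))"
      by (auto simp: dev player_cost_def[of n f s])
    also have "\<dots> \<longleftrightarrow> ?R"
      using True unfolding used is_outcome_def by blast
    finally show ?thesis
      using True by (simp add: pure_nash_def)
  qed (simp add: pure_nash_def)
qed

text \<open>
  The total of a query is not restricted, so normal-queries, under-queries and over-queries
  are all allowed.
\<close>

definition is_query :: "nat \<Rightarrow> nat \<Rightarrow> nat list \<Rightarrow> bool" where
  "is_query n m q \<longleftrightarrow> length q = m \<and> (\<forall>x\<in>set q. x \<le> n)"

definition response :: "nat \<Rightarrow> costs \<Rightarrow> nat list \<Rightarrow> real list" where
  "response m f q = map (\<lambda>i. f i (q ! i)) [0..<m]"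

text \<open>
  A deterministic adaptive algorithm is an arbitrary function from the history of queries and
  responses seen so far (oldest first) to its next action.  The parameters \<open>n\<close> and \<open>m\<close> are fixed
  and thus known to it; the cost functions enter only through the responses.
\<close>

datatype action = Query "nat list" | Output outcome

type_synonym history = "(nat list \<times> real list) list"
type_synonym algorithm = "history \<Rightarrow> action"

text \<open>A run that attempts an illegal query is stuck and never halts.\<close>

inductive reaches :: "nat \<Rightarrow> nat \<Rightarrow> algorithm \<Rightarrow> costs \<Rightarrow> history \<Rightarrow> bool"
  for n m A f where
  start: "reaches n m A f []"
| ask: "reaches n m A f h \<Longrightarrow> A h = Query q \<Longrightarrow> is_query n m q \<Longrightarrow>
    reaches n m A f (h @ [(q, response m f q)])"

definition halts_with :: "nat \<Rightarrow> nat \<Rightarrow> algorithm \<Rightarrow> costs \<Rightarrow> nat \<Rightarrow> outcome \<Rightarrow> bool" where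
  "halts_with n m A f k s \<longleftrightarrow> (\<exists>h. reaches n m A f h \<and> length h = k \<and> A h = Output s)"

lemma reaches_take:
  assumes "reaches n m A f h" "i < length h"
  shows "A (take i h) = Query (fst (h ! i)) \<and> snd (h ! i) = response m f (fst (h ! i))"
  using assms by (induction) (auto simp: nth_append less_Suc_eq)

lemma reaches_prefix:
  assumes "reaches n m A f h" "reaches n m A f h'" "i \<le> length h" "i \<le> length h'"
  shows "take i h = take i h'"
  using assms(3,4)
proof (induction i)
  case (Suc i)
  then show ?case
    using reaches_take[OF assms(1), of i] reaches_take[OF assms(2), of i]
    by (simp add: take_Suc_conv_app_nth prod_eq_iff)
qed simp

lemma halts_with_unique:
  assumes "halts_with n m A f k s" "halts_with n m A f k' s'"
  shows "k = k' \<and> s = s'"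
proof -
  obtain h h' where h: "reaches n m A f h" "length h = k" "A h = Output s"
    and h': "reaches n m A f h'" "length h' = k'" "A h' = Output s'"
    using assms by (auto simp: halts_with_def)
  have "\<not> k < k'"
    using reaches_prefix[OF h(1) h'(1), of k] reaches_take[OF h'(1), of k] h h' by auto
  moreover have "\<not> k' < k"
    using reaches_prefix[OF h(1) h'(1), of k'] reaches_take[OF h(1), of k'] h h' by auto
  ultimately have "k = k'" by simp
  then show ?thesis
    using reaches_prefix[OF h(1) h'(1), of k] h h' by auto
qed

definition determines_equilibrium :: "nat \<Rightarrow> nat \<Rightarrow> algorithm \<Rightarrow> bool" where
  "determines_equilibrium n m A \<longleftrightarrow>
     (\<forall>f. parallel_links_game m f \<longrightarrow> (\<exists>k s. halts_with n m A f k s \<and> pure_nash n m f s))"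

end

theory Submission
  imports Defs "HOL-Library.FuncSet"
begin

text \<open>
  Give link 0 a cost that jumps from 0 to 2 right after an unknown load \<open>t \<le> n\<close>, give link 1 the
  constant cost 1 and every other link the constant cost 3.  In every equilibrium exactly \<open>t\<close>
  players use link 0, so the \<open>n + 1\<close> games have pairwise different equilibria, whereas the answer
  to any query \<open>q\<close> depends only on whether \<open>q ! 0 \<le> t\<close>.  An adversary who always keeps the larger
  half of the remaining games forces \<open>n + 1 \<le> 2 ^ k\<close>.
\<close>

lemma reaches_take_legal:
  assumes "reaches n m A f h" "i < length h"
  shows "is_query n m (fst (h ! i))"
  using assms by induction (auto simp: nth_append less_Suc_eq)

text \<open>By determinism a longer history would pass through the halting one, where
  \<open>A\<close> outputs instead of querying. A history built by the adversary thus bounds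
  \<open>k\<close> from below.\<close>

lemma reaches_length_le_halts:
  assumes "reaches n m A f h" "halts_with n m A f k s"
  shows "length h \<le> k"
proof (rule ccontr)
  obtain h' where h': "reaches n m A f h'" "length h' = k" "A h' = Output s"
    using assms(2) by (auto simp: halts_with_def)
  assume "\<not> length h \<le> k"
  then show False
    using reaches_take[OF assms(1), of k] reaches_prefix[OF assms(1) h'(1), of k] h' by auto
qed

text \<open>An illegal query blocks the run forever, so a run that does halt can only pass
  \<open>h\<close> by a legal query. The adversary needs this to extend its history.\<close>

lemma halts_query_legal:
  assumes "reaches n m A f h" "halts_with n m A f k s" "A h = Query q"
  shows "is_query n m q"
proof -
  obtain h' where h': "reaches n m A f h'" "length h' = k" "A h' = Output s"
    using assms(2) by (auto simp: halts_with_def)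
  have "length h \<le> k"
    using assms(1,2) by (rule reaches_length_le_halts)
  with h' have h: "take (length h) h' = h"
    using reaches_prefix[OF assms(1) h'(1), of "length h"] by simp
  then have "length h < length h'"
    using \<open>length h \<le> k\<close> h' assms(3)
    by (metis action.distinct(1) le_neq_implies_less take_all_iff order_refl)
  then show ?thesis
    using reaches_take[OF h'(1)] reaches_take_legal[OF h'(1)] h assms(3) by fastforce
qed

lemma ex_large_fiber:
  assumes "finite S" "S \<noteq> {}" "card (g ` S) \<le> c"
  obtains y where "card S \<le> c * card {t \<in> S. g t = y}"
proof -
  obtain y where "card (g -` {y} \<inter> S) * card (g ` S) \<ge> card S"
    using pigeonhole_card[of g S "g ` S"] assms(1,2) by auto
  moreover have "g -` {y} \<inter> S = {t \<in> S. g t = y}"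
    by auto
  ultimately show thesis
    using that[of y] mult_le_mono1[OF assms(3), of "card {t \<in> S. g t = y}"]
    by (metis le_trans mult.commute)
qed

lemma binary_answers_lower_bound:
  assumes fin: "finite S" and ne: "S \<noteq> {}"
    and halts: "\<And>t. t \<in> S \<Longrightarrow> \<exists>k s. halts_with n m A (F t) k s"
    and separated: "\<And>t t' k k' s. t \<in> S \<Longrightarrow> t' \<in> S \<Longrightarrow>
      halts_with n m A (F t) k s \<Longrightarrow> halts_with n m A (F t') k' s \<Longrightarrow> t = t'"
    and binary: "\<And>q. is_query n m q \<Longrightarrow> card ((\<lambda>t. response m (F t) q) ` S) \<le> 2"
  shows "\<exists>t\<in>S. \<exists>k s. halts_with n m A (F t) k s \<and> card S \<le> 2 ^ k"
proof -
  \<comment> \<open>Minimality gives \<open>2 ^ j < card S\<close> for every \<open>j < i\<close>,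
    so at least two candidates survive before each of the first \<open>i\<close> queries.\<close>
  define i where "i = (LEAST i. card S \<le> 2 ^ i)"
  have i: "card S \<le> 2 ^ i"
    unfolding i_def by (rule LeastI[of _ "card S"]) (simp add: less_imp_le)
  \<comment> \<open>\<open>S'\<close> holds candidates that all produce the same history
    \<open>h\<close>; multiplying by \<open>2 ^ j\<close> expresses the halvings without
    division.\<close>
  have adversary: "\<exists>h S'. S' \<subseteq> S \<and> length h = j \<and> (\<forall>t\<in>S'. reaches n m A (F t) h) \<and>
      card S \<le> 2 ^ j * card S'" if "j \<le> i" for j
    using that
  proof (induction j)
    case 0
    show ?case
      by (intro exI[of _ "[]"] exI[of _ S]) (auto intro: reaches.start)
  next
    case (Suc j)
    then obtain h S' where S': "S' \<subseteq> S" "length h = j" "\<forall>t\<in>S'. reaches n m A (F t) h"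
        "card S \<le> 2 ^ j * card S'"
      by auto
    have finS': "finite S'"
      using S'(1) fin by (rule finite_subset)
    have "2 ^ j < card S"
      using Suc.prems not_less_Least[of j "\<lambda>i. card S \<le> 2 ^ i"] by (auto simp: i_def)
    with S'(4) have "2 ^ j * 1 < 2 ^ j * card S'"
      by linarith
    then have "1 < card S'"
      by (metis mult_less_cancel1)
    then obtain t t' where tt': "t \<in> S'" "t' \<in> S'" "t \<noteq> t'"
      using finS' by (metis One_nat_def card_le_Suc0_iff_eq not_less)
    \<comment> \<open>An output now would be shared by the two candidates \<open>t\<close> and
      \<open>t'\<close>, against \<open>separated\<close>.\<close>
    obtain q where q: "A h = Query q"
    proof (cases "A h")
      case (Query q)
      then show ?thesis
        by (rule that)
    next
      case (Output s)
      then have "halts_with n m A (F t) j s" "halts_with n m A (F t') j s"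
        using S' tt' by (auto simp: halts_with_def)
      with tt' S'(1) have "t = t'"
        by (meson separated subsetD)
      with tt'(3) show ?thesis ..
    qed
    have legal: "is_query n m q"
      using halts_query_legal[where A = A and h = h, OF _ _ q] halts[of t] S'(1,3) tt'(1) by blast
    have "card ((\<lambda>t. response m (F t) q) ` S') \<le> card ((\<lambda>t. response m (F t) q) ` S)"
      using fin S'(1) by (intro card_mono image_mono) auto
    then have "card ((\<lambda>t. response m (F t) q) ` S') \<le> 2"
      using binary[OF legal] by linarith
    moreover have "S' \<noteq> {}"
      using tt'(1) by auto
    ultimately obtain r where r: "card S' \<le> 2 * card {t \<in> S'. response m (F t) q = r}"
      using ex_large_fiber[OF finS'] by blast
    let ?S = "{t \<in> S'. response m (F t) q = r}"
    have "\<forall>t\<in>?S. reaches n m A (F t) (h @ [(q, r)])"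
      using S'(3) reaches.ask[where A = A and h = h, OF _ q legal] by auto
    moreover have "card S \<le> 2 ^ Suc j * card ?S"
      using le_trans[OF S'(4) mult_le_mono2[OF r]] by (simp add: mult_ac)
    ultimately show ?case
      using S'(1,2) by (intro exI[of _ "h @ [(q, r)]"] exI[of _ ?S]) auto
  qed
  obtain h S' where S': "S' \<subseteq> S" "length h = i" "\<forall>t\<in>S'. reaches n m A (F t) h"
      "card S \<le> 2 ^ i * card S'"
    using adversary[of i] by auto
  have "S' \<noteq> {}"
    using S'(4) fin ne by auto
  then obtain t where t: "t \<in> S'"
    by auto
  then obtain k s where ks: "halts_with n m A (F t) k s"
    using halts S'(1) by blast
  then have "i \<le> k"
    using reaches_length_le_halts S'(2,3) t by blast
  then have "card S \<le> 2 ^ k"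
    using le_trans[OF i power_increasing] by simp
  then show ?thesis
    using ks t S'(1) by blast
qed

definition threshold_costs :: "nat \<Rightarrow> costs" where
  "threshold_costs t e x = (if e = 0 then if x \<le> t then 0 else 2 else if e = 1 then 1 else 3)"

lemma threshold_costs_game: "parallel_links_game m (threshold_costs t)"
  by (auto simp: parallel_links_game_def threshold_costs_def mono_def)

text \<open>The costs never tie, so each deviation below is strictly profitable: from links beyond 1
  to link 1, from an overfull link 0 to link 1, and from link 1 to link 0 while its load is below
  \<open>t\<close>.\<close>

lemma threshold_costs_equilibrium_load:
  assumes "2 \<le> m" "t \<le> n" "pure_nash n m (threshold_costs t) s"
  shows "load n s 0 = t"
proof -
  have out: "\<And>p. p < n \<Longrightarrow> s p < m"
    using assms(3) by (simp add: pure_nash_def is_outcome_def)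
  have eq: "threshold_costs t i (load n s i) \<le> threshold_costs t j (load n s j + 1)"
    if "i < m" "j < m" "1 \<le> load n s i" "i \<noteq> j" for i j
    using assms(3) that by (simp add: pure_nash_iff_loads)
  have used: "1 \<le> load n s (s p)" if "p < n" for p
    using that by (auto simp: load_def Suc_le_eq card_gt_0_iff)
  have two_links: "s p < 2" if "p < n" for p
  proof (rule ccontr)
    assume "\<not> s p < 2"
    then show False
      using eq[of "s p" 1] out[OF that] used[OF that] assms(1)
      by (simp add: threshold_costs_def)
  qed
  have "load n s 0 \<le> t"
  proof (rule ccontr)
    assume "\<not> load n s 0 \<le> t"
    then show False
      using eq[of 0 1] assms(1) by (simp add: threshold_costs_def)
  qed
  moreover have "t \<le> load n s 0"
  proof (rule ccontr)
    assume "\<not> t \<le> load n s 0"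
    \<comment> \<open>One more player on link 0 still makes a load of at most \<open>t\<close>, so a
      player on link 1 would pay 0 there instead of 1.\<close>
    then have "load n s 1 = 0"
      using eq[of 1 0] assms(1) by (cases "load n s 1") (simp_all add: threshold_costs_def)
    then have "s p = 0" if "p < n" for p
      using used[OF that] less_2_cases[OF two_links[OF that]] by auto
    then have "{p. p < n \<and> s p = 0} = {..<n}"
      by auto
    then have "load n s 0 = n"
      by (simp add: load_def)
    then show False
      using \<open>\<not> t \<le> load n s 0\<close> assms(2) by simp
  qed
  ultimately show ?thesis
    by simp
qed

text \<open>Only the entry of link 0 varies with \<open>t\<close>, and it carries a single bit,
  whatever the total of \<open>q\<close>.\<close>

lemma card_threshold_responses: "card ((\<lambda>t. response m (threshold_costs t) q) ` S) \<le> 2"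
proof -
  define g :: "bool \<Rightarrow> real list" where
    "g b = map (\<lambda>i. if i = 0 then if b then 0 else 2 else if i = 1 then 1 else 3) [0..<m]" for b
  have "response m (threshold_costs t) q = g (q ! 0 \<le> t)" for t
    by (auto simp: response_def threshold_costs_def g_def)
  then have "(\<lambda>t. response m (threshold_costs t) q) ` S \<subseteq> {g True, g False}"
    by (smt (verit, best) image_subsetI insertCI)
  then have "card ((\<lambda>t. response m (threshold_costs t) q) ` S) \<le> card {g True, g False}"
    by (rule card_mono[rotated]) simp
  also have "\<dots> \<le> 2"
    by (simp add: card_insert_if)
  finally show ?thesis .
qed

theorem theorem17:
  fixes n m :: nat and A :: algorithm
  assumes "1 \<le> n" and "2 \<le> m"
    and "determines_equilibrium n m A"
  shows "\<exists>f k s. parallel_links_game m f \<and> halts_with n m A f k s \<and> log 2 (real n) \<le> real k"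
proof -
  have solved: "\<exists>k s. halts_with n m A (threshold_costs t) k s \<and>
      pure_nash n m (threshold_costs t) s" for t
    using assms(3) threshold_costs_game by (simp add: determines_equilibrium_def)
  \<comment> \<open>Uniqueness of the halting run makes the given \<open>s\<close> the promised
    equilibrium.\<close>
  have load: "load n s 0 = t" if "t \<le> n" "halts_with n m A (threshold_costs t) k s" for t k s
    using solved[of t] halts_with_unique[OF that(2)]
      threshold_costs_equilibrium_load[OF assms(2) that(1)] by blast
  \<comment> \<open>Both extremes \<open>t = 0\<close> and \<open>t = n\<close> count, so there are
    \<open>n + 1\<close> candidates and the bound becomes \<open>n < 2 ^ k\<close>.\<close>
  have "\<exists>t\<in>{..n}. \<exists>k s. halts_with n m A (threshold_costs t) k s \<and> card {..n} \<le> 2 ^ k"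
  proof (rule binary_answers_lower_bound)
    show "t = t'" if "t \<in> {..n}" "t' \<in> {..n}" "halts_with n m A (threshold_costs t) k s"
      "halts_with n m A (threshold_costs t') k' s" for t t' k k' s
      using load that by (metis atMost_iff)
    show "\<exists>k s. halts_with n m A (threshold_costs t) k s" for t
      using solved by blast
  qed (simp_all add: card_threshold_responses)
  then obtain t k s where halts: "halts_with n m A (threshold_costs t) k s"
    and "n < 2 ^ k"
    by (auto simp: Suc_le_eq)
  then have "real n \<le> 2 ^ k"
    by (metis less_imp_le of_nat_le_iff of_nat_numeral of_nat_power)
  then have "log 2 (real n) \<le> real k"
    using assms(1) by (simp add: log_le_iff powr_realpow)
  then show ?thesis
    using threshold_costs_game halts by blast
qed

end
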